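(* Let $A \in \mathbb{R}^{n\times n}$ be symmetric, let $E \in \mathbb{R}^{n\times k}$, and define the $(n+k)\times(n+k)$ matrices $$\tilde{A} = \begin{bmatrix} A & AE \\ E^{T}A & E^{T}AE \end{bmatrix}, \qquad \tilde{B} = \begin{bmatrix} I & E \\ E^{T} & E^{T}E \end{bmatrix}.$$ Then the pencil $\tilde{A} - \lambda \tilde{B}$ is strictly equivalent to the pencil $$\begin{bmatrix} 0 & 0 \\ 0 & A(I + EE^{T}) \end{bmatrix} - \lambda \begin{bmatrix} 0 & 0 \\ 0 & (I + EE^{T}) \end{bmatrix}.$$ Since the matrix $(I + EE^{T})$ is non-singular for any $E$, a subset of the generalized eigenvalues and eigenvectors of $(\tilde{A}, \tilde{B})$ will be related to the eigenvalues of $A$.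
   Context: $I$ denotes the $n\times n$ identity matrix. In the second pencil the upper-left zero blocks are of size $k\times k$ and the lower-right blocks are of size $n\times n$. Two $m\times m$ matrix pencils $P_1 - \lambda Q_1$ and $P_2 - \lambda Q_2$ are strictly equivalent if there exist invertible $m\times m$ matrices $L$ and $N$, independent of $\lambda$, such that $L P_1 N = P_2$ and $L Q_1 N = Q_2$. The generalized eigenvalues and eigenvectors of $(\tilde{A},\tilde{B})$ are those of the generalized eigenvalue problem $\tilde{A}\tilde{x} = \lambda \tilde{B}\tilde{x}$. *)

theory Defs
  imports Complex_Main "Jordan_Normal_Form.Char_Poly"
begin

(* The pencil P - lambda Q is represented by the pair P, Q of its coefficient matrices. *)
definition strictly_equivalent ::
  "nat \<Rightarrow> 'a :: semiring_1 mat \<Rightarrow> 'a mat \<Rightarrow> 'a mat \<Rightarrow> 'a mat \<Rightarrow> bool" where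
  "strictly_equivalent m P1 Q1 P2 Q2 \<longleftrightarrow>
     P1 \<in> carrier_mat m m \<and> Q1 \<in> carrier_mat m m \<and>
     P2 \<in> carrier_mat m m \<and> Q2 \<in> carrier_mat m m \<and>
     (\<exists>L \<in> carrier_mat m m. \<exists>N \<in> carrier_mat m m.
        invertible_mat L \<and> invertible_mat N \<and>
        L * P1 * N = P2 \<and> L * Q1 * N = Q2)"

(* No regularity of the pencil is required: a nonzero x with P x = Q x = 0 is a generalized
   eigenvector for every scalar. *)
definition gen_eigenvector ::
  "'a :: comm_ring_1 mat \<Rightarrow> 'a mat \<Rightarrow> 'a vec \<Rightarrow> 'a \<Rightarrow> bool" where
  "gen_eigenvector P Q x l \<longleftrightarrow>
     x \<in> carrier_vec (dim_col P) \<and> x \<noteq> 0\<^sub>v (dim_col P) \<and> P *\<^sub>v x = l \<cdot>\<^sub>v (Q *\<^sub>v x)"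

definition gen_eigenvalue :: "'a :: comm_ring_1 mat \<Rightarrow> 'a mat \<Rightarrow> 'a \<Rightarrow> bool" where
  "gen_eigenvalue P Q l \<longleftrightarrow> (\<exists>x. gen_eigenvector P Q x l)"

definition A_tilde :: "'a :: semiring_1 mat \<Rightarrow> 'a mat \<Rightarrow> 'a mat" where
  "A_tilde A E = four_block_mat A (A * E) (E\<^sup>T * A) (E\<^sup>T * A * E)"

definition B_tilde :: "'a :: semiring_1 mat \<Rightarrow> 'a mat" where
  "B_tilde E = four_block_mat (1\<^sub>m (dim_row E)) E (E\<^sup>T) (E\<^sup>T * E)"

definition I_plus_EEt :: "'a :: semiring_1 mat \<Rightarrow> 'a mat" where
  "I_plus_EEt E = 1\<^sub>m (dim_row E) + E * E\<^sup>T"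

definition zero_pad :: "nat \<Rightarrow> nat \<Rightarrow> 'a :: zero mat \<Rightarrow> 'a mat" where
  "zero_pad k n M = four_block_mat (0\<^sub>m k k) (0\<^sub>m k n) (0\<^sub>m n k) M"

abbreviation cmat :: "real mat \<Rightarrow> complex mat" where
  "cmat \<equiv> map_mat complex_of_real"

end

(* With F = [I E] the two matrices factor as F^T A F and F^T F. The matrix
   L = [-E^T I; I 0] satisfies L F^T = [0; I], so congruence with L annihilates everything except
   the lower right block; multiplying on the right by diag(I, I + E E^T) then gives the strict
   equivalence. On vectors, F maps (u, z) to w = u + E z and F^T w has w as its first block, so the
   pencil equation reads A w = l w. Finally I + E E^T has trivial kernel since
   v . (I + E E^T) v = |v|^2 + |E^T v|^2. *)
theory Submission
  imports Defs
begin

section \<open>Inverses and dimensions of block matrices\<close>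

text \<open>Over a field a right inverse of a square matrix is two-sided, so one block product will
  suffice for each transforming matrix.\<close>

lemma invertible_mat_of_right_inverse:
  fixes A B :: "'a :: field mat"
  assumes "A \<in> carrier_mat n n" "B \<in> carrier_mat n n" "A * B = 1\<^sub>m n"
  shows "invertible_mat A"
  using assms mat_mult_left_right_inverse[OF assms]
  unfolding invertible_mat_def inverts_mat_def square_mat.simps by (metis carrier_matD)

lemma invertible_mat_obtain_inverse:
  fixes A :: "'a :: semiring_1 mat"
  assumes "invertible_mat A" and A: "A \<in> carrier_mat n n"
  obtains B where "B \<in> carrier_mat n n" "A * B = 1\<^sub>m n" "B * A = 1\<^sub>m n"
proof -
  from assms obtain B where AB: "A * B = 1\<^sub>m n" and BA: "B * A = 1\<^sub>m (dim_row B)"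
    unfolding invertible_mat_def inverts_mat_def by auto
  \<comment> \<open>\<open>inverts_mat\<close> fixes only the size of the identity, so the shape of
    \<open>B\<close> is read off by counting columns in both products.\<close>
  have "dim_row B = n" using arg_cong[OF BA, of dim_col] A by simp
  moreover have "dim_col B = n" using arg_cong[OF AB, of dim_col] by simp
  ultimately show thesis using that[of B] AB BA by auto
qed

lemma I_plus_EEt_carrier [simp]:
  "E \<in> carrier_mat n k \<Longrightarrow> I_plus_EEt E \<in> carrier_mat n n"
  unfolding I_plus_EEt_def by auto

lemma A_tilde_carrier [simp]:
  "A \<in> carrier_mat n n \<Longrightarrow> E \<in> carrier_mat n k \<Longrightarrow> A_tilde A E \<in> carrier_mat (n + k) (n + k)"
  unfolding A_tilde_def by (intro four_block_carrier_mat) auto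

text \<open>Makes every block computation for \<open>A_tilde\<close> yield the one for
  \<open>B_tilde\<close> by specialization.\<close>

lemma B_tilde_eq_A_tilde_one:
  assumes "E \<in> carrier_mat n k"
  shows "B_tilde E = A_tilde (1\<^sub>m n) E"
  using assms unfolding B_tilde_def A_tilde_def by auto

lemma zero_pad_carrier [simp]:
  "M \<in> carrier_mat n n \<Longrightarrow> zero_pad k n M \<in> carrier_mat (n + k) (n + k)"
  unfolding zero_pad_def by (metis add.commute four_block_carrier_mat zero_carrier_mat)

section \<open>Strict equivalence of the two pencils\<close>

text \<open>With L the left factor, the right factor is L^T diag(I, M). Leaving \<open>A\<close> and
  \<open>M\<close> free covers both coefficients of the pencil with the same two factors.\<close>

lemma A_tilde_reduction:
  fixes A E M :: "'a :: comm_ring_1 mat"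
  assumes A: "A \<in> carrier_mat n n" and E: "E \<in> carrier_mat n k" and M: "M \<in> carrier_mat n n"
  shows "four_block_mat (- E\<^sup>T) (1\<^sub>m k) (1\<^sub>m n) (0\<^sub>m n k) * A_tilde A E
         * four_block_mat (- E) M (1\<^sub>m k) (0\<^sub>m k n) = zero_pad k n (A * M)"
proof -
  have Et: "E\<^sup>T \<in> carrier_mat k n" using E by simp
  have "four_block_mat (- E\<^sup>T) (1\<^sub>m k) (1\<^sub>m n) (0\<^sub>m n k) * A_tilde A E
      = four_block_mat (- E\<^sup>T * A + 1\<^sub>m k * (E\<^sup>T * A)) (- E\<^sup>T * (A * E) + 1\<^sub>m k * (E\<^sup>T * A * E))
          (1\<^sub>m n * A + 0\<^sub>m n k * (E\<^sup>T * A)) (1\<^sub>m n * (A * E) + 0\<^sub>m n k * (E\<^sup>T * A * E))"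
    unfolding A_tilde_def by (rule mult_four_block_mat) (use A E in auto)
  \<comment> \<open>The second block row of \<open>A_tilde\<close> is E^T times the first; L
    subtracts that multiple and swaps the rows.\<close>
  also have "- E\<^sup>T * A + 1\<^sub>m k * (E\<^sup>T * A) = 0\<^sub>m k n"
    using A E by simp
  also have "- E\<^sup>T * (A * E) + 1\<^sub>m k * (E\<^sup>T * A * E) = 0\<^sub>m k k"
    using A E assoc_mult_mat[OF Et A E] by simp
  also have "1\<^sub>m n * A + 0\<^sub>m n k * (E\<^sup>T * A) = A"
    using A E by (subst left_mult_zero_mat[of _ k n]) auto
  also have "1\<^sub>m n * (A * E) + 0\<^sub>m n k * (E\<^sup>T * A * E) = A * E"
    using A E by (subst left_mult_zero_mat[of _ k k]) auto
  finally have L: "four_block_mat (- E\<^sup>T) (1\<^sub>m k) (1\<^sub>m n) (0\<^sub>m n k) * A_tilde A E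
      = four_block_mat (0\<^sub>m k n) (0\<^sub>m k k) A (A * E)" .
  \<comment> \<open>The same cancellation on columns: the remaining second block column is the first
    times \<open>E\<close>.\<close>
  have "\<dots> * four_block_mat (- E) M (1\<^sub>m k) (0\<^sub>m k n)
      = four_block_mat (0\<^sub>m k n * - E + 0\<^sub>m k k * 1\<^sub>m k) (0\<^sub>m k n * M + 0\<^sub>m k k * 0\<^sub>m k n)
          (A * - E + A * E * 1\<^sub>m k) (A * M + A * E * 0\<^sub>m k n)"
    by (rule mult_four_block_mat) (use A E M in auto)
  also have "0\<^sub>m k n * - E + 0\<^sub>m k k * 1\<^sub>m k = 0\<^sub>m k k"
    using E by (subst left_mult_zero_mat[of _ n k]) auto
  also have "0\<^sub>m k n * M + 0\<^sub>m k k * 0\<^sub>m k n = 0\<^sub>m k n"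
    using M by simp
  also have "A * - E + A * E * 1\<^sub>m k = 0\<^sub>m n k"
    using A E by simp
  also have "A * M + A * E * 0\<^sub>m k n = A * M"
    using A E M by (subst right_mult_zero_mat[of _ n k]) auto
  finally show ?thesis unfolding L zero_pad_def .
qed

text \<open>Over a general field I + E E^T can be singular, as for the 1 by 1 complex matrix E = i,
  so its invertibility is assumed. It makes the right factor invertible.\<close>

lemma strictly_equivalent_tilde:
  fixes A E :: "'a :: field mat"
  assumes A: "A \<in> carrier_mat n n" and E: "E \<in> carrier_mat n k"
    and inv: "invertible_mat (I_plus_EEt E)"
  shows "strictly_equivalent (n + k) (A_tilde A E) (B_tilde E)
           (zero_pad k n (A * I_plus_EEt E)) (zero_pad k n (I_plus_EEt E))"
proof -
  let ?M = "I_plus_EEt E"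
  let ?L = "four_block_mat (- E\<^sup>T) (1\<^sub>m k) (1\<^sub>m n) (0\<^sub>m n k)"
  let ?N = "four_block_mat (- E) ?M (1\<^sub>m k) (0\<^sub>m k n)"
  have M: "?M \<in> carrier_mat n n" using E by simp
  obtain S where S: "S \<in> carrier_mat n n" and MS: "?M * S = 1\<^sub>m n"
    using invertible_mat_obtain_inverse[OF inv M] by metis
  have Lc: "?L \<in> carrier_mat (n + k) (n + k)"
    using four_block_carrier_mat[of "- E\<^sup>T" k n "0\<^sub>m n k" n k] E by (simp add: add.commute)
  have Nc: "?N \<in> carrier_mat (n + k) (n + k)"
    using four_block_carrier_mat[of "- E" n k "0\<^sub>m k n" k n] E by (simp add: add.commute)
  have "invertible_mat ?L"
  proof (rule invertible_mat_of_right_inverse[OF Lc])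
    \<comment> \<open>Solving (-E^T a + b, a) = (p, q) gives a = q and b = p + E^T q.\<close>
    let ?L' = "four_block_mat (0\<^sub>m n k) (1\<^sub>m n) (1\<^sub>m k) (E\<^sup>T)"
    show "?L' \<in> carrier_mat (n + k) (n + k)"
      using four_block_carrier_mat[of "0\<^sub>m n k" n k "E\<^sup>T" k n] E by (simp add: add.commute)
    have "?L * ?L' = four_block_mat (- E\<^sup>T * 0\<^sub>m n k + 1\<^sub>m k * 1\<^sub>m k) (- E\<^sup>T * 1\<^sub>m n + 1\<^sub>m k * E\<^sup>T)
        (1\<^sub>m n * 0\<^sub>m n k + 0\<^sub>m n k * 1\<^sub>m k) (1\<^sub>m n * 1\<^sub>m n + 0\<^sub>m n k * E\<^sup>T)"
      by (rule mult_four_block_mat) (use E in auto)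
    also have "- E\<^sup>T * 0\<^sub>m n k + 1\<^sub>m k * 1\<^sub>m k = 1\<^sub>m k"
      using E by (subst right_mult_zero_mat[of _ k n]) auto
    also have "- E\<^sup>T * 1\<^sub>m n + 1\<^sub>m k * E\<^sup>T = 0\<^sub>m k n" using E by simp
    also have "1\<^sub>m n * 0\<^sub>m n k + 0\<^sub>m n k * 1\<^sub>m k = (0\<^sub>m n k :: 'a mat)" by simp
    also have "1\<^sub>m n * 1\<^sub>m n + 0\<^sub>m n k * E\<^sup>T = 1\<^sub>m n"
      using E by (subst left_mult_zero_mat[of _ k n]) auto
    finally show "?L * ?L' = 1\<^sub>m (n + k)" by (simp add: add.commute)
  qed
  moreover have "invertible_mat ?N"
  proof (rule invertible_mat_of_right_inverse[OF Nc])
    \<comment> \<open>Solving (-E a + M b, a) = (p, q) gives a = q and b = S (p + E q), with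
      \<open>S\<close> the inverse of M.\<close>
    let ?N' = "four_block_mat (0\<^sub>m k n) (1\<^sub>m k) S (S * E)"
    show "?N' \<in> carrier_mat (n + k) (n + k)"
      using four_block_carrier_mat[of "0\<^sub>m k n" k n "S * E" n k] E S by (simp add: add.commute)
    have "?N * ?N' = four_block_mat (- E * 0\<^sub>m k n + ?M * S) (- E * 1\<^sub>m k + ?M * (S * E))
        (1\<^sub>m k * 0\<^sub>m k n + 0\<^sub>m k n * S) (1\<^sub>m k * 1\<^sub>m k + 0\<^sub>m k n * (S * E))"
      by (rule mult_four_block_mat) (use E S M in auto)
    also have "- E * 0\<^sub>m k n + ?M * S = 1\<^sub>m n"
      using E MS by (subst right_mult_zero_mat[of _ n k]) auto
    also have "- E * 1\<^sub>m k + ?M * (S * E) = 0\<^sub>m n k"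
      using E assoc_mult_mat[OF M S E] MS by simp
    also have "1\<^sub>m k * 0\<^sub>m k n + 0\<^sub>m k n * S = 0\<^sub>m k n" using S by simp
    also have "1\<^sub>m k * 1\<^sub>m k + 0\<^sub>m k n * (S * E) = 1\<^sub>m k"
      using E S by (subst left_mult_zero_mat[of _ n k]) auto
    finally show "?N * ?N' = 1\<^sub>m (n + k)" by simp
  qed
  moreover have "?L * A_tilde A E * ?N = zero_pad k n (A * ?M)"
    by (rule A_tilde_reduction[OF A E M])
  moreover have "?L * B_tilde E * ?N = zero_pad k n ?M"
    using A_tilde_reduction[OF one_carrier_mat E M] M by (simp add: B_tilde_eq_A_tilde_one[OF E])
  moreover have "B_tilde E \<in> carrier_mat (n + k) (n + k)"
    using E by (simp add: B_tilde_eq_A_tilde_one[OF E])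
  ultimately show ?thesis
    unfolding strictly_equivalent_def
    by (intro conjI bexI[OF _ Lc] bexI[OF _ Nc] A_tilde_carrier[OF A E]
        zero_pad_carrier[OF M] zero_pad_carrier[OF mult_carrier_mat[OF A M]])
qed

section \<open>Nonsingularity of I + E E^T over the reals\<close>

lemma invertible_I_plus_EEt:
  fixes E :: "real mat"
  assumes E: "E \<in> carrier_mat n k"
  shows "invertible_mat (I_plus_EEt E)"
proof -
  have M: "I_plus_EEt E \<in> carrier_mat n n" using E by simp
  have "v = 0\<^sub>v n" if v: "v \<in> carrier_vec n" and Mv: "I_plus_EEt E *\<^sub>v v = 0\<^sub>v n" for v
  proof -
    let ?w = "E\<^sup>T *\<^sub>v v"
    have w: "?w \<in> carrier_vec k" using E v by simp
    have "I_plus_EEt E *\<^sub>v v = v + E *\<^sub>v ?w"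
      unfolding I_plus_EEt_def using E v
      by (simp add: add_mult_distrib_mat_vec[of _ n n] assoc_mult_mat_vec[of _ n k])
    then have "v + E *\<^sub>v ?w = 0\<^sub>v n" using Mv by simp
    then have "0 = v \<bullet> (v + E *\<^sub>v ?w)" using v by simp
    also have "\<dots> = v \<bullet> v + v \<bullet> (E *\<^sub>v ?w)"
      using v w E by (intro scalar_prod_add_distrib) auto
    \<comment> \<open>Moving \<open>E\<close> across the scalar product turns the second term into a
      square, nonnegative over the reals.\<close>
    also have "v \<bullet> (E *\<^sub>v ?w) = ?w \<bullet> ?w"
      using transpose_vec_mult_scalar[OF E w v] by simp
    moreover have "0 \<le> x \<bullet> x" for x :: "real vec"
      unfolding scalar_prod_def by (intro sum_nonneg) simp
    ultimately have "v \<bullet> v = 0" by (smt (verit, best))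
    then show ?thesis using conjugate_square_eq_0_vec[OF v] by simp
  qed
  \<comment> \<open>A trivial kernel forces a nonzero determinant, hence a unit of the matrix ring,
    which supplies a right inverse.\<close>
  then have "det (I_plus_EEt E) \<noteq> 0" using det_0_iff_vec_prod_zero[OF M] by blast
  from det_non_zero_imp_unit[OF M this] obtain B
    where "B \<in> carrier_mat n n" "I_plus_EEt E * B = 1\<^sub>m n"
    unfolding Units_def ring_mat_def by auto
  with M show ?thesis by (rule invertible_mat_of_right_inverse)
qed

section \<open>Eigenvectors of the original pencil\<close>

text \<open>This is F^T A F evaluated on a block vector: the input enters only through F (u, z) = u
  + E z.\<close>

lemma A_tilde_mult_append:
  fixes A E :: "'a :: comm_ring_1 mat"
  assumes A: "A \<in> carrier_mat n n" and E: "E \<in> carrier_mat n k"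
    and u: "u \<in> carrier_vec n" and z: "z \<in> carrier_vec k"
  shows "A_tilde A E *\<^sub>v (u @\<^sub>v z)
    = (A *\<^sub>v (u + E *\<^sub>v z)) @\<^sub>v (E\<^sup>T *\<^sub>v (A *\<^sub>v (u + E *\<^sub>v z)))"
proof -
  have Et: "E\<^sup>T \<in> carrier_mat k n" using E by simp
  have Ez: "E *\<^sub>v z \<in> carrier_vec n" using E z by simp
  have "A_tilde A E *\<^sub>v (u @\<^sub>v z)
    = (A *\<^sub>v u + A * E *\<^sub>v z) @\<^sub>v (E\<^sup>T * A *\<^sub>v u + E\<^sup>T * A * E *\<^sub>v z)"
    unfolding A_tilde_def by (rule four_block_mat_mult_vec) (use assms in auto)
  moreover have "A *\<^sub>v u + A * E *\<^sub>v z = A *\<^sub>v (u + E *\<^sub>v z)"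
    by (simp add: mult_add_distrib_mat_vec[OF A u Ez] assoc_mult_mat_vec[OF A E z])
  moreover have "E\<^sup>T * A *\<^sub>v u + E\<^sup>T * A * E *\<^sub>v z = E\<^sup>T * A *\<^sub>v (u + E *\<^sub>v z)"
    using mult_add_distrib_mat_vec[OF mult_carrier_mat[OF Et A] u Ez]
      assoc_mult_mat_vec[OF mult_carrier_mat[OF Et A] E z] by simp
  moreover have "\<dots> = E\<^sup>T *\<^sub>v (A *\<^sub>v (u + E *\<^sub>v z))"
    using assoc_mult_mat_vec[OF Et A] u Ez by simp
  ultimately show ?thesis by simp
qed

lemma B_tilde_mult_append:
  fixes E :: "'a :: comm_ring_1 mat"
  assumes E: "E \<in> carrier_mat n k" and u: "u \<in> carrier_vec n" and z: "z \<in> carrier_vec k"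
  shows "B_tilde E *\<^sub>v (u @\<^sub>v z) = (u + E *\<^sub>v z) @\<^sub>v (E\<^sup>T *\<^sub>v (u + E *\<^sub>v z))"
proof -
  have "u + E *\<^sub>v z \<in> carrier_vec n" using assms by simp
  then show ?thesis
    using A_tilde_mult_append[OF one_carrier_mat E u z] by (simp add: B_tilde_eq_A_tilde_one[OF E])
qed

text \<open>The first block of the pencil equation is the eigenvector equation for w = u + E z, and
  the second is E^T applied to it. Requiring a nonzero image under \<open>B_tilde\<close> excludes
  exactly w = 0.\<close>

lemma gen_eigenvector_tilde_iff:
  fixes A E :: "'a :: comm_ring_1 mat"
  assumes A: "A \<in> carrier_mat n n" and E: "E \<in> carrier_mat n k"
    and u: "u \<in> carrier_vec n" and z: "z \<in> carrier_vec k"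
  shows "gen_eigenvector (A_tilde A E) (B_tilde E) (u @\<^sub>v z) l \<and>
           B_tilde E *\<^sub>v (u @\<^sub>v z) \<noteq> 0\<^sub>v (n + k) \<longleftrightarrow> eigenvector A (u + E *\<^sub>v z) l"
proof -
  let ?w = "u + E *\<^sub>v z"
  have Et: "E\<^sup>T \<in> carrier_mat k n" using E by simp
  have w: "?w \<in> carrier_vec n" using u E z by simp
  have Bt: "B_tilde E \<in> carrier_mat (n + k) (n + k)"
    using E by (simp add: B_tilde_eq_A_tilde_one[OF E])
  have col: "dim_col (A_tilde A E) = n + k" using A_tilde_carrier[OF A E] by simp
  have nonzero: "B_tilde E *\<^sub>v (u @\<^sub>v z) \<noteq> 0\<^sub>v (n + k) \<longleftrightarrow> ?w \<noteq> 0\<^sub>v n"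
  proof -
    have "0\<^sub>v (n + k) = 0\<^sub>v n @\<^sub>v (0\<^sub>v k :: 'a vec)" by auto
    moreover have "E\<^sup>T *\<^sub>v 0\<^sub>v n = 0\<^sub>v k" using Et by auto
    ultimately show ?thesis
      unfolding B_tilde_mult_append[OF E u z] using append_vec_eq[OF w zero_carrier_vec] by metis
  qed
  have x_nonzero: "u @\<^sub>v z \<noteq> 0\<^sub>v (n + k)" if "B_tilde E *\<^sub>v (u @\<^sub>v z) \<noteq> 0\<^sub>v (n + k)"
    using that Bt by auto
  \<comment> \<open>With \<open>l\<close> moved inside, both sides of the pencil equation have the
    form (p, E^T p), so comparing first blocks decides equality.\<close>
  have scale: "l \<cdot>\<^sub>v (?w @\<^sub>v (E\<^sup>T *\<^sub>v ?w)) = (l \<cdot>\<^sub>v ?w) @\<^sub>v (E\<^sup>T *\<^sub>v (l \<cdot>\<^sub>v ?w))"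
  proof -
    have "E\<^sup>T *\<^sub>v (l \<cdot>\<^sub>v ?w) = l \<cdot>\<^sub>v (E\<^sup>T *\<^sub>v ?w)"
      using Et w by (intro eq_vecI) auto
    then show ?thesis by (intro eq_vecI) auto
  qed
  have "A_tilde A E *\<^sub>v (u @\<^sub>v z) = l \<cdot>\<^sub>v (B_tilde E *\<^sub>v (u @\<^sub>v z)) \<longleftrightarrow> A *\<^sub>v ?w = l \<cdot>\<^sub>v ?w"
    unfolding A_tilde_mult_append[OF A E u z] B_tilde_mult_append[OF E u z] scale
    using append_vec_eq[of "A *\<^sub>v ?w" n "l \<cdot>\<^sub>v ?w"] A w by auto
  then show ?thesis
    unfolding gen_eigenvector_def eigenvector_def col using nonzero x_nonzero w u z A by auto
qed

lemma eigenvalue_tilde_iff: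
  fixes A E :: "'a :: comm_ring_1 mat"
  assumes A: "A \<in> carrier_mat n n" and E: "E \<in> carrier_mat n k"
  shows "(\<exists>x. gen_eigenvector (A_tilde A E) (B_tilde E) x l \<and> B_tilde E *\<^sub>v x \<noteq> 0\<^sub>v (n + k))
    \<longleftrightarrow> eigenvalue A l"
proof
  assume "\<exists>x. gen_eigenvector (A_tilde A E) (B_tilde E) x l \<and> B_tilde E *\<^sub>v x \<noteq> 0\<^sub>v (n + k)"
  then obtain x where x: "gen_eigenvector (A_tilde A E) (B_tilde E) x l"
    and nz: "B_tilde E *\<^sub>v x \<noteq> 0\<^sub>v (n + k)" by blast
  have "x \<in> carrier_vec (n + k)"
    using x A_tilde_carrier[OF A E] unfolding gen_eigenvector_def by simp
  then have "vec_first x n @\<^sub>v vec_last x k = x" by simp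
  then show "eigenvalue A l"
    using gen_eigenvector_tilde_iff[OF A E, of "vec_first x n" "vec_last x k" l] x nz
    unfolding eigenvalue_def by auto
next
  assume "eigenvalue A l"
  then obtain w where ev: "eigenvector A w l" unfolding eigenvalue_def by blast
  then have w: "w \<in> carrier_vec n" using A unfolding eigenvector_def by simp
  \<comment> \<open>The preimage of \<open>w\<close> under F is chosen as (w, 0).\<close>
  have "E *\<^sub>v 0\<^sub>v k = 0\<^sub>v n" using E by auto
  then have "eigenvector A (w + E *\<^sub>v 0\<^sub>v k) l" using ev w by simp
  with gen_eigenvector_tilde_iff[OF A E w zero_carrier_vec]
  show "\<exists>x. gen_eigenvector (A_tilde A E) (B_tilde E) x l \<and> B_tilde E *\<^sub>v x \<noteq> 0\<^sub>v (n + k)"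
    by blast
qed

section \<open>Eigenvectors of the nonzero block of the reduced pencil\<close>

text \<open>Substituting w = M y turns A M y = l M y into A w = l w; invertibility of
  \<open>M\<close> keeps nonzero vectors nonzero.\<close>

lemma gen_eigenvector_mult_right_iff:
  fixes A M :: "'a :: comm_ring_1 mat"
  assumes A: "A \<in> carrier_mat n n" and M: "M \<in> carrier_mat n n" and inv: "invertible_mat M"
    and y: "y \<in> carrier_vec n"
  shows "gen_eigenvector (A * M) M y l \<longleftrightarrow> eigenvector A (M *\<^sub>v y) l"
proof -
  obtain S where S: "S \<in> carrier_mat n n" and SM: "S * M = 1\<^sub>m n"
    using invertible_mat_obtain_inverse[OF inv M] by metis
  have "S *\<^sub>v (M *\<^sub>v y) = y"
    using assoc_mult_mat_vec[OF S M y] SM y by simp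
  moreover have "M *\<^sub>v 0\<^sub>v n = 0\<^sub>v n" "S *\<^sub>v 0\<^sub>v n = 0\<^sub>v n" using M S by auto
  ultimately have "y = 0\<^sub>v n \<longleftrightarrow> M *\<^sub>v y = 0\<^sub>v n" by metis
  then show ?thesis
    unfolding gen_eigenvector_def eigenvector_def
    using A M y assoc_mult_mat_vec[OF A M y] by auto
qed

lemma gen_eigenvalue_mult_right_iff:
  fixes A M :: "'a :: comm_ring_1 mat"
  assumes A: "A \<in> carrier_mat n n" and M: "M \<in> carrier_mat n n" and inv: "invertible_mat M"
  shows "gen_eigenvalue (A * M) M l \<longleftrightarrow> eigenvalue A l"
proof
  assume "gen_eigenvalue (A * M) M l"
  then obtain y where y: "gen_eigenvector (A * M) M y l" unfolding gen_eigenvalue_def by blast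
  then have "y \<in> carrier_vec n" using M unfolding gen_eigenvector_def by simp
  then show "eigenvalue A l"
    using gen_eigenvector_mult_right_iff[OF A M inv] y unfolding eigenvalue_def by blast
next
  assume "eigenvalue A l"
  then obtain w where ev: "eigenvector A w l" unfolding eigenvalue_def by blast
  then have w: "w \<in> carrier_vec n" using A unfolding eigenvector_def by simp
  obtain S where S: "S \<in> carrier_mat n n" and MS: "M * S = 1\<^sub>m n"
    using invertible_mat_obtain_inverse[OF inv M] by metis
  \<comment> \<open>The generalized eigenvector belonging to \<open>w\<close> is its preimage
    \<open>S *\<^sub>v w\<close> under \<open>M\<close>.\<close>
  have "M *\<^sub>v (S *\<^sub>v w) = w" using assoc_mult_mat_vec[OF M S w] MS w by simp
  moreover have "S *\<^sub>v w \<in> carrier_vec n" using S w by simp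
  ultimately show "gen_eigenvalue (A * M) M l"
    using gen_eigenvector_mult_right_iff[OF A M inv] ev unfolding gen_eigenvalue_def by metis
qed

section \<open>Transfer from real to complex matrices\<close>

lemma (in comm_ring_hom) map_mat_A_tilde:
  assumes A: "A \<in> carrier_mat n n" and E: "E \<in> carrier_mat n k"
  shows "map_mat hom (A_tilde A E) = A_tilde (map_mat hom A) (map_mat hom E)"
proof -
  have Et: "E\<^sup>T \<in> carrier_mat k n" using E by simp
  have "map_mat hom (A_tilde A E) = four_block_mat (map_mat hom A) (map_mat hom (A * E))
      (map_mat hom (E\<^sup>T * A)) (map_mat hom (E\<^sup>T * A * E))"
    unfolding A_tilde_def by (rule map_four_block_mat) (use A E in auto)
  then show ?thesis
    unfolding A_tilde_def
    using mat_hom_mult[OF A E] mat_hom_mult[OF Et A]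
      mat_hom_mult[OF mult_carrier_mat[OF Et A] E]
    by (simp add: map_mat_transpose)
qed

lemma (in comm_ring_hom) map_mat_B_tilde:
  assumes E: "E \<in> carrier_mat n k"
  shows "map_mat hom (B_tilde E) = B_tilde (map_mat hom E)"
proof -
  have "map_mat hom E \<in> carrier_mat n k" using E by simp
  from B_tilde_eq_A_tilde_one[OF this] show ?thesis
    using map_mat_A_tilde[OF one_carrier_mat E]
    by (simp add: B_tilde_eq_A_tilde_one[OF E] mat_hom_one)
qed

text \<open>The positivity argument is confined to real matrices, so invertibility over the complex
  numbers comes from the image of the real inverse.\<close>

lemma (in comm_ring_hom) invertible_mat_map_mat:
  assumes A: "A \<in> carrier_mat n n" and inv: "invertible_mat A"
  shows "invertible_mat (map_mat hom A)"
proof -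
  obtain B where B: "B \<in> carrier_mat n n" "A * B = 1\<^sub>m n" "B * A = 1\<^sub>m n"
    using invertible_mat_obtain_inverse[OF inv A] .
  then have "map_mat hom A * map_mat hom B = 1\<^sub>m n" "map_mat hom B * map_mat hom A = 1\<^sub>m n"
    using mat_hom_mult[OF A B(1)] mat_hom_mult[OF B(1) A] by (simp_all add: mat_hom_one)
  then show ?thesis
    using A B(1) unfolding invertible_mat_def inverts_mat_def by auto
qed

text \<open>For k > 0 the pencil is singular: vectors (-E z, z) are annihilated by both coefficients
  and satisfy the equation for every scalar. Hence the restriction to vectors outside the kernel of
  \<open>B_tilde\<close>, and the use of the nonzero block alone for the reduced pencil. Passing to
  \<open>cmat\<close> captures all complex eigenvalues.\<close>

theorem theorem3p2:
  fixes A E :: "real mat" and n k :: nat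
  assumes A: "A \<in> carrier_mat n n" and sym: "A\<^sup>T = A"
    and E: "E \<in> carrier_mat n k"
  shows "strictly_equivalent (n + k) (A_tilde A E) (B_tilde E)
           (zero_pad k n (A * I_plus_EEt E)) (zero_pad k n (I_plus_EEt E)) \<and>
         invertible_mat (I_plus_EEt E) \<and>
         {l. \<exists>x. gen_eigenvector (cmat (A_tilde A E)) (cmat (B_tilde E)) x l \<and>
                 cmat (B_tilde E) *\<^sub>v x \<noteq> 0\<^sub>v (n + k)} = {l. eigenvalue (cmat A) l} \<and>
         (\<forall>u \<in> carrier_vec n. \<forall>z \<in> carrier_vec k. \<forall>l.
            gen_eigenvector (cmat (A_tilde A E)) (cmat (B_tilde E)) (u @\<^sub>v z) l \<and>
            cmat (B_tilde E) *\<^sub>v (u @\<^sub>v z) \<noteq> 0\<^sub>v (n + k)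
            \<longleftrightarrow> eigenvector (cmat A) (u + cmat E *\<^sub>v z) l) \<and>
         {l. gen_eigenvalue (cmat (A * I_plus_EEt E)) (cmat (I_plus_EEt E)) l}
            = {l. eigenvalue (cmat A) l} \<and>
         (\<forall>y \<in> carrier_vec n. \<forall>l.
            gen_eigenvector (cmat (A * I_plus_EEt E)) (cmat (I_plus_EEt E)) y l
            \<longleftrightarrow> eigenvector (cmat A) (cmat (I_plus_EEt E) *\<^sub>v y) l)"
proof -
  let ?M = "I_plus_EEt E"
  have M: "?M \<in> carrier_mat n n" using E by simp
  have inv: "invertible_mat ?M" by (rule invertible_I_plus_EEt[OF E])
  have cA: "cmat A \<in> carrier_mat n n" and cE: "cmat E \<in> carrier_mat n k"
    and cM: "cmat ?M \<in> carrier_mat n n"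
    using A E M by auto
  have cinv: "invertible_mat (cmat ?M)"
    by (rule of_real_hom.invertible_mat_map_mat[OF M inv])
  \<comment> \<open>\<open>cmat\<close> is pushed inwards but stays around
    \<open>I_plus_EEt E\<close>, since the lemmas on the reduced pencil accept any invertible right
    factor.\<close>
  note hom = of_real_hom.map_mat_A_tilde[OF A E] of_real_hom.map_mat_B_tilde[OF E]
    of_real_hom.mat_hom_mult[OF A M]
  show ?thesis
    unfolding hom
    by (intro conjI ballI allI Collect_cong strictly_equivalent_tilde[OF A E inv] inv
        eigenvalue_tilde_iff[OF cA cE] gen_eigenvector_tilde_iff[OF cA cE]
        gen_eigenvalue_mult_right_iff[OF cA cM cinv]
        gen_eigenvector_mult_right_iff[OF cA cM cinv])
qed

end
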